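(* Let $x^\ast$ be a local minimizer of the MPVC. If $x^\ast$ satisfies MPVC-CPLD, then $x^\ast$ is an enhanced M-stationary point of the MPVC.
   Context: The mathematical program with vanishing constraints (MPVC) is: minimize $f(x)$ over $x\in\mathbb{R}^n$ subject to $g_i(x)\le 0$ ($i=1,\dots,m$), $h_i(x)=0$ ($i=1,\dots,p$), $H_i(x)\ge 0$ and $G_i(x)H_i(x)\le 0$ ($i=1,\dots,q$), where all functions $f,g_i,h_i,G_i,H_i:\mathbb{R}^n\to\mathbb{R}$ are continuously differentiable. Let $\mathcal{C}$ be its feasible set. For $x^\ast\in\mathcal{C}$ put $I_g=\{i: g_i(x^\ast)=0\}$, $I_+=\{i:H_i(x^\ast)>0\}$, $I_{+0}=\{i:H_i(x^\ast)>0,G_i(x^\ast)=0\}$, $I_{+-}=\{i:H_i(x^\ast)>0,G_i(x^\ast)<0\}$, $I_{00}=\{i:H_i(x^\ast)=0,G_i(x^\ast)=0\}$, $I_{0+}=\{i:H_i(x^\ast)=0,G_i(x^\ast)>0\}$, $I_{0-}=\{i:H_i(x^\ast)=0,G_i(x^\ast)<0\}$. MPVC-CPLD holds at $x^\ast\in\mathcal{C}$ if and only if for any index sets $I_h\subset\{1,\dots,p\}$, $J_0\subset I_g$, $L_0^H\subset I_{0+}\cup I_{00}\cup I_{0-}$, $L_0^G\subset I_{+0}\cup I_{00}$: whenever there exist $\lambda_j\ge0$ ($j\in J_0$), $\mu_i$ ($i\in I_h$), $\eta_l^H$ ($l\in L_0^H$), $\eta_l^G$ ($l\in L_0^G$),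 not all zero, such that $$\sum_{j\in J_0}\lambda_j\nabla g_j(x^\ast)+\sum_{i\in I_h}\mu_i\nabla h_i(x^\ast)+\sum_{l\in L_0^G}\eta_l^G\nabla G_l(x^\ast)-\sum_{l\in L_0^H}\eta_l^H\nabla H_l(x^\ast)=0$$ and $\eta_l^G\eta_l^H=0$ for all $l\in I_{00}$ (with $\eta_l^G:=0$ for $l\notin L_0^G$ and $\eta_l^H:=0$ for $l\notin L_0^H$), then there is a neighbourhood $U(x^\ast)$ of $x^\ast$ such that for every $x\in U(x^\ast)$ the family of vectors $\{\nabla h_i(x)\}_{i\in I_h}$, $\{\nabla g_j(x)\}_{j\in J_0}$, $\{\nabla G_l(x)\}_{l\in L_0^G}$, $\{\nabla H_l(x)\}_{l\in L_0^H}$ is linearly dependent. A feasible point $x^\ast\in\mathcal{C}$ is enhanced M-stationary if and only if there are multipliers $(\lambda,\mu,\eta^G,\eta^H)\in\mathbb{R}^m\times\mathbb{R}^p\times\mathbb{R}^q\times\mathbb{R}^q$ with $(\lambda,\mu,\eta^G,\eta^H)\neq(0,0,0,0)$ such that: (i) $\nabla f(x^\ast)+\sum_{i=1}^m\lambda_i\nabla g_i(x^\ast)+\sum_{i=1}^p\mu_i\nabla h_i(x^\ast)+\sum_{i=1}^q\eta_i^G\nabla G_i(x^\ast)-\sum_{i=1}^q\eta_i^H\nabla H_i(x^\ast)=0$; (ii) $\lambda_i\ge0$ for $i\in I_g$, $\lambda_i=0$ for $i\notin I_g$; $\eta_i^G=0$ for $i\in I_{+-}\cup I_{0-}\cup I_{0+}$,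 $\eta_i^G\ge0$ for $i\in I_{+0}\cup I_{00}$; $\eta_i^H=0$ for $i\in I_+$, $\eta_i^H\ge0$ for $i\in I_{0-}$, $\eta_i^H$ free for $i\in I_{0+}$; $\eta_i^G\eta_i^H=0$ for $i\in I_{00}$; (iii) if $\lambda,\mu,\eta^G,\eta^H$ are not all equal to zero, then there is a sequence $x^k\to x^\ast$ in $\mathbb{R}^n$ such that for all $k\in\mathbb{N}$: $\lambda_i>0\Rightarrow\lambda_ig_i(x^k)>0$ ($i=1,\dots,m$); $\mu_i\ne0\Rightarrow\mu_ih_i(x^k)>0$ ($i=1,\dots,p$); $\eta_i^H\ne0\Rightarrow\eta_i^HH_i(x^k)<0$ ($i=1,\dots,q$); $\eta_i^G>0\Rightarrow\eta_i^GG_i(x^k)>0$ ($i=1,\dots,q$).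
   Formalization: The requirement that the multipliers (λ,μ,η^G,η^H) be nonzero is dropped from enhanced M-stationarity: with it the claim fails, e.g. f(x)=x², g(x)=x−1, x*=0. When ∇f(x* )≠0, condition (i) already forces a nonzero multiplier. *)

theory Defs
  imports "HOL-Analysis.Analysis"
begin

definition grad :: "('a::real_inner \<Rightarrow> real) \<Rightarrow> 'a \<Rightarrow> 'a" where
  "grad f x = (THE D. GDERIV f x :> D)"

lemma grad_eq:
  assumes "GDERIV f x :> D"
  shows "grad f x = D"
  unfolding grad_def
proof (rule the_equality)
  fix D' assume "GDERIV f x :> D'"
  with assms have "(\<lambda>h. inner h D') = (\<lambda>h. inner h D)"
    unfolding gderiv_def by (rule has_derivative_unique[rotated])
  then have "inner (D' - D) (D' - D) = 0"
    by (metis inner_diff_right eq_iff_diff_eq_0)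
  then show "D' = D" by simp
qed (rule assms)

definition cont_differentiable :: "('a::real_inner \<Rightarrow> real) \<Rightarrow> bool" where
  "cont_differentiable f \<longleftrightarrow>
     (\<exists>f'. (\<forall>x. GDERIV f x :> f' x) \<and> continuous_on UNIV f')"

text \<open>Linear dependence of an indexed family, as opposed to a set of vectors: a family in
  which a vector is repeated is dependent, and the empty family is independent.\<close>

definition family_dependent :: "'i set \<Rightarrow> ('i \<Rightarrow> 'a::real_vector) \<Rightarrow> bool" where
  "family_dependent I v \<longleftrightarrow>
     (\<exists>c :: 'i \<Rightarrow> real. (\<exists>i\<in>I. c i \<noteq> 0) \<and> (\<Sum>i\<in>I. c i *\<^sub>R v i) = 0)"

text \<open>The constraint families are indexed from 1; only the indices \<open>{1..num_ineq P}\<close>,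
  \<open>{1..num_eq P}\<close> and \<open>{1..num_van P}\<close> are relevant. Each family may be empty.\<close>

record 'n mpvc =
  obj :: "real ^ 'n \<Rightarrow> real"
  num_ineq :: nat
  ineq :: "nat \<Rightarrow> real ^ 'n \<Rightarrow> real"
  num_eq :: nat
  eqn :: "nat \<Rightarrow> real ^ 'n \<Rightarrow> real"
  num_van :: nat
  vanG :: "nat \<Rightarrow> real ^ 'n \<Rightarrow> real"
  vanH :: "nat \<Rightarrow> real ^ 'n \<Rightarrow> real"

definition mpvc_C1 :: "'n::finite mpvc \<Rightarrow> bool" where
  "mpvc_C1 P \<longleftrightarrow>
     cont_differentiable (obj P) \<and>
     (\<forall>i\<in>{1..num_ineq P}. cont_differentiable (ineq P i)) \<and>
     (\<forall>i\<in>{1..num_eq P}. cont_differentiable (eqn P i)) \<and>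
     (\<forall>i\<in>{1..num_van P}. cont_differentiable (vanG P i) \<and> cont_differentiable (vanH P i))"

definition feasible :: "'n::finite mpvc \<Rightarrow> (real ^ 'n) set" where
  "feasible P = {x.
     (\<forall>i\<in>{1..num_ineq P}. ineq P i x \<le> 0) \<and>
     (\<forall>i\<in>{1..num_eq P}. eqn P i x = 0) \<and>
     (\<forall>i\<in>{1..num_van P}. vanH P i x \<ge> 0 \<and> vanG P i x * vanH P i x \<le> 0)}"

definition local_minimizer :: "'n::finite mpvc \<Rightarrow> real ^ 'n \<Rightarrow> bool" where
  "local_minimizer P x \<longleftrightarrow>
     x \<in> feasible P \<and>
     (\<exists>U. open U \<and> x \<in> U \<and> (\<forall>y\<in>feasible P \<inter> U. obj P x \<le> obj P y))"

text \<open>In the names of the index sets the first letter gives the sign of H and the second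
  that of G: \<open>p\<close> positive, \<open>z\<close> zero, \<open>n\<close> negative.\<close>

definition I_g :: "'n::finite mpvc \<Rightarrow> real ^ 'n \<Rightarrow> nat set" where
  "I_g P x = {i\<in>{1..num_ineq P}. ineq P i x = 0}"

definition I_p :: "'n::finite mpvc \<Rightarrow> real ^ 'n \<Rightarrow> nat set" where
  "I_p P x = {i\<in>{1..num_van P}. vanH P i x > 0}"

definition I_pz :: "'n::finite mpvc \<Rightarrow> real ^ 'n \<Rightarrow> nat set" where
  "I_pz P x = {i\<in>{1..num_van P}. vanH P i x > 0 \<and> vanG P i x = 0}"

definition I_pn :: "'n::finite mpvc \<Rightarrow> real ^ 'n \<Rightarrow> nat set" where
  "I_pn P x = {i\<in>{1..num_van P}. vanH P i x > 0 \<and> vanG P i x < 0}"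

definition I_zz :: "'n::finite mpvc \<Rightarrow> real ^ 'n \<Rightarrow> nat set" where
  "I_zz P x = {i\<in>{1..num_van P}. vanH P i x = 0 \<and> vanG P i x = 0}"

definition I_zp :: "'n::finite mpvc \<Rightarrow> real ^ 'n \<Rightarrow> nat set" where
  "I_zp P x = {i\<in>{1..num_van P}. vanH P i x = 0 \<and> vanG P i x > 0}"

definition I_zn :: "'n::finite mpvc \<Rightarrow> real ^ 'n \<Rightarrow> nat set" where
  "I_zn P x = {i\<in>{1..num_van P}. vanH P i x = 0 \<and> vanG P i x < 0}"

text \<open>The premise below extends the multipliers of G and H by zero outside \<open>LG\<close> and \<open>LH\<close>,
  so that the complementarity condition on \<open>I_zz\<close> makes sense. Apart from the
  multipliers of the inequality constraints, no sign is imposed. In the conclusion the four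
  families of gradients are joined into one family over the disjoint sum of the index sets.\<close>

definition mpvc_cpld :: "'n::finite mpvc \<Rightarrow> real ^ 'n \<Rightarrow> bool" where
  "mpvc_cpld P x \<longleftrightarrow> x \<in> feasible P \<and>
     (\<forall>Ih J LH LG.
        Ih \<subseteq> {1..num_eq P} \<longrightarrow> J \<subseteq> I_g P x \<longrightarrow>
        LH \<subseteq> I_zp P x \<union> I_zz P x \<union> I_zn P x \<longrightarrow> LG \<subseteq> I_pz P x \<union> I_zz P x \<longrightarrow>
        (\<exists>lam mu etaH etaG :: nat \<Rightarrow> real.
           (\<forall>j\<in>J. lam j \<ge> 0) \<and>
           (\<forall>l. l \<notin> LG \<longrightarrow> etaG l = 0) \<and> (\<forall>l. l \<notin> LH \<longrightarrow> etaH l = 0) \<and>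
           ((\<exists>j\<in>J. lam j \<noteq> 0) \<or> (\<exists>i\<in>Ih. mu i \<noteq> 0) \<or>
            (\<exists>l\<in>LH. etaH l \<noteq> 0) \<or> (\<exists>l\<in>LG. etaG l \<noteq> 0)) \<and>
           (\<Sum>j\<in>J. lam j *\<^sub>R grad (ineq P j) x) + (\<Sum>i\<in>Ih. mu i *\<^sub>R grad (eqn P i) x)
             + (\<Sum>l\<in>LG. etaG l *\<^sub>R grad (vanG P l) x)
             - (\<Sum>l\<in>LH. etaH l *\<^sub>R grad (vanH P l) x) = 0 \<and>
           (\<forall>l\<in>I_zz P x. etaG l * etaH l = 0)) \<longrightarrow>
        (\<exists>U. open U \<and> x \<in> U \<and>
           (\<forall>y\<in>U. family_dependent (Ih <+> (J <+> (LG <+> LH)))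
              (case_sum (\<lambda>i. grad (eqn P i) y)
                (case_sum (\<lambda>j. grad (ineq P j) y)
                  (case_sum (\<lambda>l. grad (vanG P l) y) (\<lambda>l. grad (vanH P l) y)))))))"

text \<open>All multipliers are allowed to vanish simultaneously, in which case the last conjunct,
  whose premise then fails, is void and the first one reads \<open>grad (obj P) x = 0\<close>.
  Requiring a nonzero multiplier would exclude every minimizer in the interior of the feasible
  set at which no constraint is active. If \<open>grad (obj P) x\<close> is nonzero, the first conjunct
  already forces some multiplier to be nonzero.\<close>

definition enhanced_M_stationary :: "'n::finite mpvc \<Rightarrow> real ^ 'n \<Rightarrow> bool" where
  "enhanced_M_stationary P x \<longleftrightarrow> x \<in> feasible P \<and>
     (\<exists>lam mu etaG etaH :: nat \<Rightarrow> real.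
        grad (obj P) x
          + (\<Sum>i\<in>{1..num_ineq P}. lam i *\<^sub>R grad (ineq P i) x)
          + (\<Sum>i\<in>{1..num_eq P}. mu i *\<^sub>R grad (eqn P i) x)
          + (\<Sum>i\<in>{1..num_van P}. etaG i *\<^sub>R grad (vanG P i) x)
          - (\<Sum>i\<in>{1..num_van P}. etaH i *\<^sub>R grad (vanH P i) x) = 0 \<and>
        ((\<forall>i\<in>I_g P x. lam i \<ge> 0) \<and> (\<forall>i\<in>{1..num_ineq P} - I_g P x. lam i = 0) \<and>
         (\<forall>i\<in>I_pn P x \<union> I_zn P x \<union> I_zp P x. etaG i = 0) \<and>
         (\<forall>i\<in>I_pz P x \<union> I_zz P x. etaG i \<ge> 0) \<and>
         (\<forall>i\<in>I_p P x. etaH i = 0) \<and>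
         (\<forall>i\<in>I_zn P x. etaH i \<ge> 0) \<and>
         (\<forall>i\<in>I_zz P x. etaG i * etaH i = 0)) \<and>
        ((\<exists>i\<in>{1..num_ineq P}. lam i \<noteq> 0) \<or> (\<exists>i\<in>{1..num_eq P}. mu i \<noteq> 0) \<or>
         (\<exists>i\<in>{1..num_van P}. etaG i \<noteq> 0 \<or> etaH i \<noteq> 0) \<longrightarrow>
         (\<exists>X :: nat \<Rightarrow> real ^ 'n. X \<longlonglongrightarrow> x \<and>
            (\<forall>k.
               (\<forall>i\<in>{1..num_ineq P}. lam i > 0 \<longrightarrow> lam i * ineq P i (X k) > 0) \<and>
               (\<forall>i\<in>{1..num_eq P}. mu i \<noteq> 0 \<longrightarrow> mu i * eqn P i (X k) > 0) \<and>
               (\<forall>i\<in>{1..num_van P}. etaH i \<noteq> 0 \<longrightarrow> etaH i * vanH P i (X k) < 0) \<and>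
               (\<forall>i\<in>{1..num_van P}. etaG i > 0 \<longrightarrow> etaG i * vanG P i (X k) > 0)))))"

end

theory Submission
  imports Defs
begin

text \<open>Minimizing \<open>f(z) + |z - x|\<^sup>2/2 + c R(z)\<close>, where \<open>R\<close> is the sum of the squared constraint
  violations, gives points converging to \<open>x\<close> with approximate multipliers, each nonzero one having
  the sign of its constraint function there. By the conic version of Caratheodory's theorem they
  can be supported on a linearly independent family of gradients without losing these signs.
  If the reduced multipliers were unbounded, normalising them would yield in the limit a nontrivial
  dependence relation at \<open>x\<close>, and CPLD would make the family dependent near \<open>x\<close>. Hence a
  subsequence converges, and the signs pass to the multipliers in the limit.\<close>

section \<open>Preliminaries on gradients, subsequences and conic combinations\<close>

lemma cont_differentiableD:
  assumes "cont_differentiable f"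
  shows "GDERIV f x :> grad f x" and "continuous_on UNIV (grad f)" and "continuous_on UNIV f"
proof -
  obtain f' where f': "\<And>x. GDERIV f x :> f' x" "continuous_on UNIV f'"
    using assms unfolding cont_differentiable_def by blast
  have eq: "grad f = f'" using f'(1) by (auto simp: fun_eq_iff intro: grad_eq)
  show "GDERIV f x :> grad f x" "continuous_on UNIV (grad f)" using f' eq by auto
  show "continuous_on UNIV f"
    using f'(1) unfolding gderiv_def
    by (meson has_derivative_continuous continuous_at_imp_continuous_on)
qed

text \<open>Bolzano-Weierstrass is applied to one member of the family after another; passing to a
  further subsequence keeps the limits already found.\<close>

lemma finite_family_bounded_subseq:
  fixes f :: "'i \<Rightarrow> nat \<Rightarrow> real"
  assumes "finite A" and "\<And>a k. a \<in> A \<Longrightarrow> \<bar>f a k\<bar> \<le> B"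
  shows "\<exists>l (r :: nat \<Rightarrow> nat). strict_mono r \<and> (\<forall>a\<in>A. (\<lambda>k. f a (r k)) \<longlonglongrightarrow> l a)"
  using assms
proof (induction A rule: finite_induct)
  case empty
  show ?case by (intro exI[of _ id] exI) (auto simp: strict_mono_def)
next
  case (insert a A)
  have "\<exists>l (r :: nat \<Rightarrow> nat). strict_mono r \<and> (\<forall>a\<in>A. (\<lambda>k. f a (r k)) \<longlonglongrightarrow> l a)"
    using insert.prems by (intro insert.IH) auto
  then obtain l r where r: "strict_mono (r :: nat \<Rightarrow> nat)"
    and l: "\<And>a. a \<in> A \<Longrightarrow> (\<lambda>k. f a (r k)) \<longlonglongrightarrow> l a" by blast
  have "bounded (range (\<lambda>k. f a (r k)))"
    unfolding bounded_iff using insert.prems by (intro exI[of _ B]) auto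
  then obtain m s where s: "strict_mono (s :: nat \<Rightarrow> nat)" "((\<lambda>k. f a (r k)) \<circ> s) \<longlonglongrightarrow> m"
    using bounded_imp_convergent_subsequence by blast
  have "(\<lambda>k. f b ((r \<circ> s) k)) \<longlonglongrightarrow> (l(a := m)) b" if "b \<in> insert a A" for b
  proof (cases "b = a")
    case True
    then show ?thesis using s(2) by (simp add: o_def)
  next
    case False
    then show ?thesis using LIMSEQ_subseq_LIMSEQ[OF l s(1), of b] that by (simp add: o_def)
  qed
  moreover have "strict_mono (r \<circ> s)" using r s(1) by (simp add: strict_mono_o)
  ultimately show ?case by blast
qed

lemma finite_range_constant_subseq:
  fixes S :: "nat \<Rightarrow> 'b"
  assumes "finite (range S)"
  shows "\<exists>(r :: nat \<Rightarrow> nat) T. strict_mono r \<and> (\<forall>k. S (r k) = T)"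
proof -
  obtain k0 where "infinite {k. S k = S k0}"
    using pigeonhole_infinite[of UNIV S] assms by auto
  then obtain r where "strict_mono (r :: nat \<Rightarrow> nat)" "\<forall>n. r n \<in> {k. S k = S k0}"
    using infinite_enumerate[of "{k. S k = S k0}"] by blast
  moreover from this have "\<forall>n. S (r n) = S k0" by simp
  ultimately show ?thesis by blast
qed

text \<open>A dependence relation can be subtracted from the coefficients, scaled so that one of them
  becomes zero before any other changes its sign.\<close>

lemma conic_caratheodory:
  fixes v :: "'i \<Rightarrow> 'a::real_vector" and u :: "'i \<Rightarrow> real"
  assumes "finite A"
  shows "\<exists>w. (\<forall>a\<in>A. w a \<noteq> 0 \<longrightarrow> w a * u a > 0) \<and>
           (\<Sum>a\<in>A. w a *\<^sub>R v a) = (\<Sum>a\<in>A. u a *\<^sub>R v a) \<and>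
           \<not> family_dependent {a\<in>A. w a \<noteq> 0} v"
proof (induction "card {a\<in>A. u a \<noteq> 0}" arbitrary: u rule: less_induct)
  case less
  let ?S = "{a\<in>A. u a \<noteq> 0}"
  show ?case
  proof (cases "family_dependent ?S v")
    case False
    have "u a * u a > 0" if "u a \<noteq> 0" for a using that by (simp add: zero_less_mult_iff) linarith
    then show ?thesis using False by (intro exI[of _ u]) auto
  next
    case True
    then obtain c' where c': "\<exists>i\<in>?S. c' i \<noteq> (0::real)" "(\<Sum>i\<in>?S. c' i *\<^sub>R v i) = 0"
      unfolding family_dependent_def by blast
    then obtain i where i: "i \<in> ?S" "c' i \<noteq> 0" by blast
    \<comment> \<open>Up to replacing the relation by its negative, \<open>c i\<close> and
      \<open>u i\<close> have the same sign, so that the set \<open>T\<close> of coefficients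
      shrinking in modulus is nonempty.\<close>
    define c where "c = (\<lambda>j. (if c' i * u i > 0 then c' j else - c' j))"
    have c0: "(\<Sum>i\<in>?S. c i *\<^sub>R v i) = 0"
      using c'(2) by (cases "c' i * u i > 0") (simp_all add: c_def sum_negf)
    have ci: "c i * u i > 0"
      using i by (auto simp: c_def mult_less_0_iff zero_less_mult_iff)
    define T where "T = {a\<in>?S. c a * u a > 0}"
    have T: "finite T" "T \<noteq> {}" using assms i ci by (auto simp: T_def)
    \<comment> \<open>The largest step for which no coefficient of \<open>u - t * c\<close> has
      crossed zero. It is attained at some \<open>m\<close>, and this index leaves the
      support.\<close>
    define t where "t = Min ((\<lambda>a. u a / c a) ` T)"
    have "t \<in> (\<lambda>a. u a / c a) ` T" using T by (simp add: t_def)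
    then obtain m where m: "m \<in> T" "t = u m / c m" by blast
    have tle: "t \<le> u a / c a" if "a \<in> T" for a using T that by (simp add: t_def)
    have t0: "t > 0" using m by (auto simp: T_def zero_less_divide_iff zero_less_mult_iff)
    \<comment> \<open>The dependence relation constrains \<open>c\<close> only on the support of
      \<open>u\<close>. Elsewhere \<open>w\<close> is set to zero, so that the support cannot
      grow.\<close>
    define w where "w = (\<lambda>a. if u a = 0 then 0 else u a - t * c a)"
    have sgn: "w a * u a > 0" if "a \<in> A" "w a \<noteq> 0" for a
    proof (cases "c a * u a > 0")
      case True
      then have "a \<in> T" using that by (auto simp: T_def)
      note tle[OF this]
      then show ?thesis
        using True that(2)
        by (auto simp: w_def zero_less_mult_iff field_simps split: if_splits)
    next
      case False
      have u0: "u a \<noteq> 0" using that by (auto simp: w_def)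
      have "t * (c a * u a) \<le> 0" using mult_nonneg_nonpos[of t "c a * u a"] False t0 by linarith
      moreover have "u a * u a > 0" using u0 by (simp add: zero_less_mult_iff) linarith
      ultimately have "u a * u a - t * (c a * u a) > 0" by linarith
      then show ?thesis using u0 by (simp add: w_def algebra_simps)
    qed
    have sum_u: "(\<Sum>a\<in>A. u a *\<^sub>R v a) = (\<Sum>a\<in>?S. u a *\<^sub>R v a)"
      using assms by (intro sum.mono_neutral_right) auto
    have "(\<Sum>a\<in>A. w a *\<^sub>R v a) = (\<Sum>a\<in>?S. w a *\<^sub>R v a)"
      using assms by (intro sum.mono_neutral_right) (auto simp: w_def)
    also have "\<dots> = (\<Sum>a\<in>?S. u a *\<^sub>R v a - t *\<^sub>R (c a *\<^sub>R v a))"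
      by (intro sum.cong) (auto simp: w_def algebra_simps)
    also have "\<dots> = (\<Sum>a\<in>A. u a *\<^sub>R v a)"
      unfolding sum_subtractf scaleR_sum_right[symmetric] c0 sum_u by simp
    finally have sum_w: "(\<Sum>a\<in>A. w a *\<^sub>R v a) = (\<Sum>a\<in>A. u a *\<^sub>R v a)" .
    have "m \<in> ?S" "w m = 0" using m by (auto simp: T_def w_def)
    moreover have "{a\<in>A. w a \<noteq> 0} \<subseteq> ?S" by (auto simp: w_def)
    ultimately have "{a\<in>A. w a \<noteq> 0} \<subset> ?S" by blast
    then have "card {a\<in>A. w a \<noteq> 0} < card ?S" using assms by (intro psubset_card_mono) auto
    from less.hyps[OF this] obtain z where
      z: "\<forall>a\<in>A. z a \<noteq> 0 \<longrightarrow> z a * w a > 0"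
        "(\<Sum>a\<in>A. z a *\<^sub>R v a) = (\<Sum>a\<in>A. w a *\<^sub>R v a)"
        "\<not> family_dependent {a\<in>A. z a \<noteq> 0} v" by blast
    have "z a * u a > 0" if "a \<in> A" "z a \<noteq> 0" for a
    proof -
      have zw: "z a * w a > 0" using z(1) that by blast
      then have "w a * u a > 0" by (intro sgn that) auto
      with zw show ?thesis by (auto simp: zero_less_mult_iff)
    qed
    then show ?thesis using z sum_w by (intro exI[of _ z]) auto
  qed
qed

section \<open>Quadratic penalties and their first-order condition\<close>

text \<open>Let \<open>y k\<close> minimize the function with penalty parameter \<open>k\<close> on
  a small ball around \<open>x\<close>. Comparison with \<open>x\<close> bounds
  \<open>real k * \<Theta> (y k)\<close>, so \<open>\<Theta>\<close> vanishes at a cluster point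
  \<open>l\<close>, and then \<open>f l + (l - x) \<bullet> (l - x) / 2 \<le> f x \<le> f l\<close>
  forces \<open>l = x\<close>. Hence some \<open>y k\<close> close to \<open>x\<close> lies in the
  open ball and is an unconstrained local minimizer. The quadratic term makes up for
  \<open>x\<close> not being a strict minimizer.\<close>

lemma penalty_local_minimizer:
  fixes f \<Theta> :: "'a::euclidean_space \<Rightarrow> real"
  assumes f: "continuous_on UNIV f" and \<Theta>: "continuous_on UNIV \<Theta>"
    and nonneg: "\<And>z. \<Theta> z \<ge> 0" and zero: "\<Theta> x = 0"
    and U: "open U" "x \<in> U" and min: "\<And>z. z \<in> U \<Longrightarrow> \<Theta> z = 0 \<Longrightarrow> f x \<le> f z"
    and "\<delta> > 0"
  shows "\<exists>c\<ge>0. \<exists>y V. dist y x < \<delta> \<and> open V \<and> y \<in> V \<and>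
    (\<forall>z\<in>V. f y + (y - x) \<bullet> (y - x) / 2 + c * \<Theta> y \<le> f z + (z - x) \<bullet> (z - x) / 2 + c * \<Theta> z)"
proof -
  obtain e where e: "e > 0" "cball x e \<subseteq> U" using U open_contains_cball by blast
  define \<phi> where "\<phi> = (\<lambda>(k::nat) z. f z + (z - x) \<bullet> (z - x) / 2 + real k * \<Theta> z)"
  have "\<exists>y\<in>cball x e. \<forall>z\<in>cball x e. \<phi> k y \<le> \<phi> k z" for k
    unfolding \<phi>_def using e
    by (intro continuous_attains_inf)
      (auto intro!: continuous_intros intro: continuous_on_subset[OF f] continuous_on_subset[OF \<Theta>])
  then obtain y where y: "\<And>k. y k \<in> cball x e"
    and ymin: "\<And>k z. z \<in> cball x e \<Longrightarrow> \<phi> k (y k) \<le> \<phi> k z" by metis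
  \<comment> \<open>A lower bound of \<open>f\<close> on the ball turns the comparison with
    \<open>x\<close> into a bound of order \<open>1 / k\<close> on
    \<open>\<Theta> (y k)\<close>.\<close>
  have "\<exists>z\<in>cball x e. \<forall>z'\<in>cball x e. f z \<le> f z'"
    using e by (intro continuous_attains_inf) (auto intro: continuous_on_subset[OF f])
  then obtain b where b: "\<And>z. z \<in> cball x e \<Longrightarrow> b \<le> f z" by blast
  obtain l r where l: "l \<in> cball x e" "strict_mono (r :: nat \<Rightarrow> nat)" "(y \<circ> r) \<longlonglongrightarrow> l"
    using y compact_cball[of x e] unfolding compact_def by blast
  have le: "\<phi> k (y k) \<le> f x" for k
    using ymin[of x k] e zero by (simp add: \<phi>_def)
  have "real k * \<Theta> (y k) \<le> f x - b" for k
    using le[of k] b[OF y, of k] inner_ge_zero[of "y k - x"] unfolding \<phi>_def by linarith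
  then have "\<Theta> (y k) \<le> (f x - b) * inverse (real k)" if "k > 0" for k
    using that by (simp add: field_simps)
  then have ev: "\<forall>\<^sub>F k in sequentially. \<Theta> (y k) \<le> (f x - b) * inverse (real k)"
    using eventually_gt_at_top[of "0::nat"] by (rule eventually_mono[rotated])
  have "(\<lambda>k. (f x - b) * inverse (real k)) \<longlonglongrightarrow> (f x - b) * 0"
    by (intro tendsto_intros lim_inverse_n)
  then have "(\<lambda>k. \<Theta> (y k)) \<longlonglongrightarrow> 0"
    using nonneg ev by (intro tendsto_sandwich[OF _ ev tendsto_const]) auto
  then have "((\<lambda>k. \<Theta> (y k)) \<circ> r) \<longlonglongrightarrow> 0" by (rule LIMSEQ_subseq_LIMSEQ) (rule l)
  moreover have "(\<lambda>k. \<Theta> ((y \<circ> r) k)) \<longlonglongrightarrow> \<Theta> l"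
    using l(3) \<Theta> by (intro isCont_tendsto_compose[of l \<Theta>]) (auto simp: continuous_on_eq_continuous_at o_def)
  ultimately have "\<Theta> l = 0" using LIMSEQ_unique by (auto simp: o_def)
  then have fl: "f x \<le> f l" using min l(1) e by blast
  have "(\<lambda>k. f ((y \<circ> r) k)) \<longlonglongrightarrow> f l"
    using l(3) f by (intro isCont_tendsto_compose[of l f]) (auto simp: continuous_on_eq_continuous_at o_def)
  then have "(\<lambda>k. f ((y \<circ> r) k) + ((y \<circ> r) k - x) \<bullet> ((y \<circ> r) k - x) / 2)
      \<longlonglongrightarrow> f l + (l - x) \<bullet> (l - x) / 2"
    using l(3) unfolding o_def by (intro tendsto_intros) auto
  moreover have "f ((y \<circ> r) k) + ((y \<circ> r) k - x) \<bullet> ((y \<circ> r) k - x) / 2 \<le> f x" for k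
    using le[of "r k"] mult_nonneg_nonneg[OF of_nat_0_le_iff nonneg, of "r k" "y (r k)"]
    unfolding \<phi>_def o_def by linarith
  ultimately have "f l + (l - x) \<bullet> (l - x) / 2 \<le> f x"
    by (intro tendsto_upperbound[OF _ always_eventually]) auto
  with fl have "(l - x) \<bullet> (l - x) = 0" using inner_ge_zero[of "l - x"] by linarith
  then have "l = x" by simp
  with l(3) have "\<forall>\<^sub>F k in sequentially. dist ((y \<circ> r) k) x < min \<delta> e"
    using \<open>\<delta> > 0\<close> e(1) unfolding o_def by (intro tendstoD) auto
  then obtain k where k: "dist (y (r k)) x < min \<delta> e"
    unfolding eventually_sequentially o_def by blast
  show ?thesis
    using k ymin[of _ "r k"] unfolding \<phi>_def
    by (intro exI[of _ "real (r k)"] conjI exI[of _ "y (r k)"] exI[of _ "ball x e"])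
      (auto simp: dist_commute)
qed

text \<open>Fermat's rule. The weights \<open>s\<close> and shifts \<open>b\<close> are arbitrary,
  so that it applies to a smooth majorant of the penalty function.\<close>

lemma local_minimizer_squares_gradient:
  fixes f :: "'a::real_inner \<Rightarrow> real"
  assumes f: "GDERIV f y :> D" and F: "\<And>a. a \<in> A \<Longrightarrow> GDERIV (F a) y :> DF a"
    and V: "open V" "y \<in> V"
    and min: "\<And>z. z \<in> V \<Longrightarrow>
      f y + (y - x) \<bullet> (y - x) / 2 + (\<Sum>a\<in>A. s a * (F a y - b a)\<^sup>2)
      \<le> f z + (z - x) \<bullet> (z - x) / 2 + (\<Sum>a\<in>A. s a * (F a z - b a)\<^sup>2)"
  shows "D + (y - x) + (\<Sum>a\<in>A. (2 * s a * (F a y - b a)) *\<^sub>R DF a) = 0" (is "?G = 0")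
proof -
  have F': "(F a has_derivative (\<lambda>h. h \<bullet> DF a)) (at y)" if "a \<in> A" for a
    using F[OF that] by (simp add: gderiv_def)
  have f': "(f has_derivative (\<lambda>h. h \<bullet> D)) (at y)"
    using f by (simp add: gderiv_def)
  have "((\<lambda>z. f z + (z - x) \<bullet> (z - x) / 2 + (\<Sum>a\<in>A. s a * (F a z - b a)\<^sup>2))
      has_derivative (\<lambda>h. h \<bullet> ?G)) (at y)"
    unfolding inner_add_right inner_sum_right
  proof (intro has_derivative_add has_derivative_sum f')
    show "((\<lambda>z. (z - x) \<bullet> (z - x) / 2) has_derivative (\<lambda>h. h \<bullet> (y - x))) (at y)"
      by (auto intro!: derivative_eq_intros simp: inner_commute)
    show "((\<lambda>z. s a * (F a z - b a)\<^sup>2)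
        has_derivative (\<lambda>h. h \<bullet> ((2 * s a * (F a y - b a)) *\<^sub>R DF a))) (at y)" if "a \<in> A" for a
      by (auto intro!: derivative_eq_intros F' that simp: algebra_simps)
  qed
  then have "(\<lambda>h. h \<bullet> ?G) = (\<lambda>h. 0)"
    using differential_zero_maxmin[OF V(2) V(1)] min by blast
  then have "?G \<bullet> ?G = 0" by (rule fun_cong)
  then show ?thesis by simp
qed


section \<open>The constraints as one family, their violation and its smooth majorant\<close>

text \<open>The blocks stand in the same order as in the gradient family of
  \<open>mpvc_cpld\<close>: equations, inequalities, \<open>G\<close>, \<open>H\<close>. One
  multiplier function on the disjoint sum then replaces four.\<close>

definition constr_idx :: "'n::finite mpvc \<Rightarrow> (nat + nat + nat + nat) set" where
  "constr_idx P =
     {1..num_eq P} <+> ({1..num_ineq P} <+> ({1..num_van P} <+> {1..num_van P}))"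

definition constr :: "'n::finite mpvc \<Rightarrow> nat + nat + nat + nat \<Rightarrow> real ^ 'n \<Rightarrow> real" where
  "constr P = case_sum (eqn P) (case_sum (ineq P) (case_sum (vanG P) (vanH P)))"

lemma constr_simps [simp]:
  "constr P (Inl i) = eqn P i"
  "constr P (Inr (Inl i)) = ineq P i"
  "constr P (Inr (Inr (Inl i))) = vanG P i"
  "constr P (Inr (Inr (Inr i))) = vanH P i"
  by (simp_all add: constr_def)

lemma constr_idx_iff [simp]:
  "Inl i \<in> constr_idx P \<longleftrightarrow> i \<in> {1..num_eq P}"
  "Inr (Inl i) \<in> constr_idx P \<longleftrightarrow> i \<in> {1..num_ineq P}"
  "Inr (Inr (Inl i)) \<in> constr_idx P \<longleftrightarrow> i \<in> {1..num_van P}"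
  "Inr (Inr (Inr i)) \<in> constr_idx P \<longleftrightarrow> i \<in> {1..num_van P}"
  by (auto simp: constr_idx_def)

lemma finite_constr_idx: "finite (constr_idx P)"
  by (simp add: constr_idx_def)

lemma sum_constr_idx:
  "sum F (constr_idx P) =
     (\<Sum>i\<in>{1..num_eq P}. F (Inl i)) + ((\<Sum>i\<in>{1..num_ineq P}. F (Inr (Inl i))) +
     ((\<Sum>i\<in>{1..num_van P}. F (Inr (Inr (Inl i)))) +
      (\<Sum>i\<in>{1..num_van P}. F (Inr (Inr (Inr i))))))"
  by (simp add: constr_idx_def sum.Plus o_def)

lemma cont_differentiable_constr:
  "mpvc_C1 P \<Longrightarrow> a \<in> constr_idx P \<Longrightarrow> cont_differentiable (constr P a)"
  by (auto simp: mpvc_C1_def constr_idx_def)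

text \<open>The constraints whose violation contributes to the squared distance of
  \<open>(G, H)\<close> to the set \<open>{(a, b). b \<ge> 0 \<and> a * b \<le> 0}\<close>, which is
  \<open>(min (max G 0) H)\<^sup>2\<close>: the nearest point lies on the axis \<open>G = 0\<close> if
  \<open>0 < G < H\<close>, and on the axis \<open>H = 0\<close> if \<open>H \<le> max G 0\<close>.\<close>

definition violated :: "'n::finite mpvc \<Rightarrow> real ^ 'n \<Rightarrow> nat + nat + nat + nat \<Rightarrow> bool" where
  "violated P y = case_sum (\<lambda>i. True) (case_sum (\<lambda>i. ineq P i y > 0)
     (case_sum (\<lambda>i. 0 < vanG P i y \<and> vanG P i y < vanH P i y)
       (\<lambda>i. vanH P i y \<le> max (vanG P i y) 0)))"

lemma violated_simps [simp]:
  "violated P y (Inl i)"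
  "violated P y (Inr (Inl i)) \<longleftrightarrow> ineq P i y > 0"
  "violated P y (Inr (Inr (Inl i))) \<longleftrightarrow> 0 < vanG P i y \<and> vanG P i y < vanH P i y"
  "violated P y (Inr (Inr (Inr i))) \<longleftrightarrow> vanH P i y \<le> max (vanG P i y) 0"
  by (simp_all add: violated_def)

text \<open>The squared distance of the tuple of constraint values to the set of admissible values.
  It is continuous, but the last sum may have a kink where \<open>G = H > 0\<close>.\<close>

definition residual :: "'n::finite mpvc \<Rightarrow> real ^ 'n \<Rightarrow> real" where
  "residual P z = (\<Sum>i\<in>{1..num_eq P}. (eqn P i z)\<^sup>2)
     + (\<Sum>i\<in>{1..num_ineq P}. (max (ineq P i z) 0)\<^sup>2)
     + (\<Sum>i\<in>{1..num_van P}. (min (max (vanG P i z) 0) (vanH P i z))\<^sup>2)"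

lemma residual_nonneg: "residual P z \<ge> 0"
  by (simp add: residual_def sum_nonneg)

lemma residual_eq_0_iff: "residual P z = 0 \<longleftrightarrow> z \<in> feasible P"
proof -
  have pos: "max u 0 = 0 \<longleftrightarrow> u \<le> 0" for u :: real by auto
  have van: "min (max u 0) v = 0 \<longleftrightarrow> v \<ge> 0 \<and> u * v \<le> 0" for u v :: real
    by (auto simp: min_def max_def mult_le_0_iff)
  have "u + v + w = 0 \<longleftrightarrow> u = 0 \<and> v = 0 \<and> w = 0" if "u \<ge> 0" "v \<ge> 0" "w \<ge> 0" for u v w :: real
    using that by linarith
  then show ?thesis
    by (auto simp: residual_def feasible_def sum_nonneg sum_nonneg_eq_0_iff pos van)
qed

lemma continuous_on_residual:
  assumes "mpvc_C1 P"
  shows "continuous_on UNIV (residual P)"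
  unfolding residual_def using assms
  by (intro continuous_intros) (auto simp: mpvc_C1_def dest: cont_differentiableD(3))

text \<open>The weights \<open>s\<close> select the branch of each vanishing constraint that is active at \<open>y\<close>,
  and the shifts \<open>b\<close> come from \<open>(max u 0)\<^sup>2 \<le> (u - min w 0)\<^sup>2\<close>, with equality for \<open>u = w\<close>.
  The squares thus touch the nonsmooth residual from above at \<open>y\<close>, so that a local minimizer
  of the penalty function also minimizes a smooth function.\<close>

lemma residual_majorant:
  assumes C1: "mpvc_C1 P"
  shows "\<exists>s b V. residual P y = (\<Sum>a\<in>constr_idx P. s a * (constr P a y - b a)\<^sup>2) \<and>
    open V \<and> y \<in> V \<and>
    (\<forall>z\<in>V. residual P z \<le> (\<Sum>a\<in>constr_idx P. s a * (constr P a z - b a)\<^sup>2)) \<and>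
    (\<forall>a\<in>constr_idx P. s a * (constr P a y - b a) \<noteq> 0 \<longrightarrow>
      violated P y a \<and> s a * (constr P a y - b a) * constr P a y > 0)"
proof -
  \<comment> \<open>A tie between \<open>H\<close> and \<open>max G 0\<close> goes to the branch of
    \<open>H\<close>, in agreement with \<open>violated\<close>. On the branch of \<open>G\<close>
    the shift makes the summand vanish at \<open>y\<close> whenever \<open>G \<le> 0\<close>
    there.\<close>
  define sG where "sG = (\<lambda>i. if vanH P i y > max (vanG P i y) 0 then 1 else 0 :: real)"
  define s where "s = (case_sum (\<lambda>_. 1) (case_sum (\<lambda>_. 1) (case_sum sG (\<lambda>i. 1 - sG i))) :: nat + nat + nat + nat \<Rightarrow> real)"
  define b where "b = (case_sum (\<lambda>_. 0) (case_sum (\<lambda>i. min (ineq P i y) 0)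
    (case_sum (\<lambda>i. min (vanG P i y) 0) (\<lambda>_. 0))) :: nat + nat + nat + nat \<Rightarrow> real)"
  note sb = s_def b_def sG_def
  have pos: "max u 0 = u - min u 0" for u :: real by auto
  have eq: "residual P y = (\<Sum>a\<in>constr_idx P. s a * (constr P a y - b a)\<^sup>2)"
    unfolding residual_def sum_constr_idx add.assoc sum.distrib[symmetric]
    by (intro arg_cong2[of _ _ _ _ "(+)"] sum.cong) (auto simp: sb pos min_def)
  \<comment> \<open>On the branch of \<open>G\<close> the estimate needs \<open>H > 0\<close> also
    at \<open>z\<close>: a negative \<open>H\<close> would contribute its own square to the
    residual.\<close>
  define V where "V = {z. \<forall>i\<in>{1..num_van P}. vanH P i y > max (vanG P i y) 0 \<longrightarrow>
      vanH P i z > 0}"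
  have "open {z. vanH P i z > 0}" if "i \<in> {1..num_van P}" for i
    using C1 that by (intro open_Collect_less continuous_intros)
      (auto simp: mpvc_C1_def dest: cont_differentiableD(3))
  then have "open (\<Inter>i\<in>{i\<in>{1..num_van P}. vanH P i y > max (vanG P i y) 0}. {z. vanH P i z > 0})"
    by (intro open_INT) auto
  moreover have "V = (\<Inter>i\<in>{i\<in>{1..num_van P}. vanH P i y > max (vanG P i y) 0}. {z. vanH P i z > 0})"
    by (auto simp: V_def)
  ultimately have "open V" by simp
  have sq: "(max u 0)\<^sup>2 \<le> (u - min w 0)\<^sup>2" for u w :: real
    by (rule abs_le_square_iff[THEN iffD1]) (auto simp: max_def min_def)
  have le: "residual P z \<le> (\<Sum>a\<in>constr_idx P. s a * (constr P a z - b a)\<^sup>2)"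
    if z: "z \<in> V" for z
  proof -
    have "(min (max (vanG P i z) 0) (vanH P i z))\<^sup>2
        \<le> s (Inr (Inr (Inl i))) * (vanG P i z - b (Inr (Inr (Inl i))))\<^sup>2
          + s (Inr (Inr (Inr i))) * (vanH P i z - b (Inr (Inr (Inr i))))\<^sup>2"
      if i: "i \<in> {1..num_van P}" for i
    proof (cases "vanH P i y > max (vanG P i y) 0")
      case True
      then have "vanH P i z > 0" using z i by (simp add: V_def)
      then have "(min (max (vanG P i z) 0) (vanH P i z))\<^sup>2 \<le> (max (vanG P i z) 0)\<^sup>2"
        by (intro power_mono) auto
      also have "\<dots> \<le> (vanG P i z - min (vanG P i y) 0)\<^sup>2" by (rule sq)
      finally show ?thesis using True by (auto simp: sb)
    next
      case False
      \<comment> \<open>This bound holds for every \<open>z\<close>, so the branch of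
        \<open>H\<close> puts no restriction on \<open>V\<close>.\<close>
      have "(min (max (vanG P i z) 0) (vanH P i z))\<^sup>2 \<le> (vanH P i z)\<^sup>2"
        by (rule abs_le_square_iff[THEN iffD1]) auto
      then show ?thesis using False by (auto simp: sb)
    qed
    then show "residual P z \<le> (\<Sum>a\<in>constr_idx P. s a * (constr P a z - b a)\<^sup>2)"
      unfolding residual_def sum_constr_idx add.assoc sum.distrib[symmetric]
      by (intro add_mono sum_mono) (auto simp: sb intro: sq)
  qed
  have viol: "violated P y a \<and> s a * (constr P a y - b a) * constr P a y > 0"
    if "a \<in> constr_idx P" "s a * (constr P a y - b a) \<noteq> 0" for a
    using that by (auto simp: sb constr_idx_def min_def max_def simp flip: power2_eq_square split: if_splits)
  have "y \<in> V" by (auto simp: V_def)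
  with eq le viol \<open>open V\<close> show ?thesis by blast
qed

section \<open>Approximate multipliers and their limits\<close>

text \<open>Near \<open>x\<close> the penalty function has a local minimizer \<open>y\<close>, which
  also minimizes the smooth majorant locally. The coefficients of the gradients in its first-order
  condition are the multipliers, and each nonzero one has the sign of its constraint function. The
  conic reduction makes the supporting gradients independent and keeps the remaining signs.\<close>

lemma approximate_multipliers:
  assumes C1: "mpvc_C1 P" and "local_minimizer P x" and "\<delta> > 0"
  shows "\<exists>y \<nu>. dist y x < \<delta> \<and>
    grad (obj P) y + (y - x) + (\<Sum>a\<in>constr_idx P. \<nu> a *\<^sub>R grad (constr P a) y) = 0 \<and>
    (\<forall>a\<in>constr_idx P. \<nu> a \<noteq> 0 \<longrightarrow> \<nu> a * constr P a y > 0 \<and> violated P y a) \<and>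
    \<not> family_dependent {a\<in>constr_idx P. \<nu> a \<noteq> 0} (\<lambda>a. grad (constr P a) y)"
proof -
  let ?A = "constr_idx P" and ?f = "obj P"
  have obj: "cont_differentiable ?f" using C1 by (simp add: mpvc_C1_def)
  obtain U where U: "open U" "x \<in> U" "\<And>y. y \<in> feasible P \<Longrightarrow> y \<in> U \<Longrightarrow> ?f x \<le> ?f y"
    and x: "x \<in> feasible P"
    using assms(2) unfolding local_minimizer_def by blast
  obtain c y V where c: "c \<ge> (0::real)" and y: "dist y x < \<delta>" and V: "open V" "y \<in> V"
    and min: "\<And>z. z \<in> V \<Longrightarrow> ?f y + (y - x) \<bullet> (y - x) / 2 + c * residual P y
      \<le> ?f z + (z - x) \<bullet> (z - x) / 2 + c * residual P z"
    using penalty_local_minimizer[OF cont_differentiableD(3)[OF obj] continuous_on_residual[OF C1]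
        residual_nonneg residual_eq_0_iff[THEN iffD2, OF x] U(1,2) U(3) \<open>\<delta> > 0\<close>]
    unfolding residual_eq_0_iff by blast
  obtain s b W where eq: "residual P y = (\<Sum>a\<in>?A. s a * (constr P a y - b a)\<^sup>2)"
    and W: "open W" "y \<in> W"
      "\<And>z. z \<in> W \<Longrightarrow> residual P z \<le> (\<Sum>a\<in>?A. s a * (constr P a z - b a)\<^sup>2)"
    and viol: "\<And>a. a \<in> ?A \<Longrightarrow> s a * (constr P a y - b a) \<noteq> 0 \<Longrightarrow>
      violated P y a \<and> s a * (constr P a y - b a) * constr P a y > 0"
    using residual_majorant[OF C1, of y] by blast
  have min': "?f y + (y - x) \<bullet> (y - x) / 2 + (\<Sum>a\<in>?A. (c * s a) * (constr P a y - b a)\<^sup>2)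
      \<le> ?f z + (z - x) \<bullet> (z - x) / 2 + (\<Sum>a\<in>?A. (c * s a) * (constr P a z - b a)\<^sup>2)"
    if "z \<in> V \<inter> W" for z
    using min[of z] mult_left_mono[OF W(3)[of z] c] that
    unfolding eq sum_distrib_left mult.assoc by force
  define \<mu> where "\<mu> = (\<lambda>a. 2 * (c * s a) * (constr P a y - b a))"
  have grad0: "grad ?f y + (y - x) + (\<Sum>a\<in>?A. \<mu> a *\<^sub>R grad (constr P a) y) = 0"
    unfolding \<mu>_def
    using cont_differentiableD(1)[OF obj] cont_differentiableD(1)[OF cont_differentiable_constr[OF C1]]
      open_Int[OF V(1) W(1)] V(2) W(2) min'
    by (intro local_minimizer_squares_gradient[where V = "V \<inter> W" and f = ?f]) auto
  have \<mu>: "\<mu> a * constr P a y > 0 \<and> violated P y a" if "a \<in> ?A" "\<mu> a \<noteq> 0" for a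
  proof -
    have "c > 0" "s a * (constr P a y - b a) \<noteq> 0" using that c by (auto simp: \<mu>_def)
    with viol[OF that(1)] have "2 * c * (s a * (constr P a y - b a) * constr P a y) > 0"
      "violated P y a" by simp_all
    then show ?thesis by (simp add: \<mu>_def mult_ac)
  qed
  obtain \<nu> where \<nu>: "\<And>a. a \<in> ?A \<Longrightarrow> \<nu> a \<noteq> 0 \<Longrightarrow> \<nu> a * \<mu> a > 0"
    "(\<Sum>a\<in>?A. \<nu> a *\<^sub>R grad (constr P a) y) = (\<Sum>a\<in>?A. \<mu> a *\<^sub>R grad (constr P a) y)"
    "\<not> family_dependent {a\<in>?A. \<nu> a \<noteq> 0} (\<lambda>a. grad (constr P a) y)"
    using conic_caratheodory[OF finite_constr_idx, of P \<mu> "\<lambda>a. grad (constr P a) y"] by blast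
  have "\<nu> a * constr P a y > 0 \<and> violated P y a" if "a \<in> ?A" "\<nu> a \<noteq> 0" for a
    using \<nu>(1)[OF that] \<mu>[OF that(1)] by (auto simp: zero_less_mult_iff)
  then show ?thesis
    using y grad0 \<nu> by (intro exI[of _ y] exI[of _ \<nu>]) simp
qed

text \<open>Normalising \<open>(1, \<nu>)\<close> treats bounded and unbounded multipliers at once; in the unbounded
  case the weight \<open>\<tau>\<close> of the objective is zero.\<close>

lemma multiplier_limit:
  fixes X :: "nat \<Rightarrow> 'a::real_normed_vector" and D :: "'i \<Rightarrow> 'a \<Rightarrow> 'a"
  assumes "finite A" and X: "X \<longlonglongrightarrow> x"
    and D0: "isCont D0 x" and D: "\<And>a. a \<in> A \<Longrightarrow> isCont (D a) x"
    and eq: "\<And>k. D0 (X k) + (X k - x) + (\<Sum>a\<in>A. \<nu> k a *\<^sub>R D a (X k)) = 0"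
  shows "\<exists>(r :: nat \<Rightarrow> nat) S M \<tau> l. strict_mono r \<and> (\<forall>k. {a\<in>A. \<nu> (r k) a \<noteq> 0} = S) \<and>
    (\<forall>k. M k > 0) \<and> (\<forall>a\<in>A. (\<lambda>k. \<nu> (r k) a / M k) \<longlonglongrightarrow> l a) \<and>
    \<tau> \<ge> 0 \<and> \<tau> + (\<Sum>a\<in>A. \<bar>l a\<bar>) = (1::real) \<and>
    \<tau> *\<^sub>R D0 x + (\<Sum>a\<in>A. l a *\<^sub>R D a x) = 0"
proof -
  \<comment> \<open>Only finitely many supports are possible, so one of them recurs along a
    subsequence. This gives CPLD a fixed family of indices.\<close>
  have "finite (range (\<lambda>k. {a\<in>A. \<nu> k a \<noteq> 0}))"
    by (rule finite_subset[of _ "Pow A"]) (use \<open>finite A\<close> in auto)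
  then obtain q S where q: "strict_mono (q :: nat \<Rightarrow> nat)" "\<And>k. {a\<in>A. \<nu> (q k) a \<noteq> 0} = S"
    using finite_range_constant_subseq[of "\<lambda>k. {a\<in>A. \<nu> k a \<noteq> 0}"] by blast
  \<comment> \<open>The sum norm of \<open>(1, \<nu>)\<close>, where the entry 1 is the coefficient
    of the objective gradient.\<close>
  define N where "N = (\<lambda>k. 1 + (\<Sum>a\<in>A. \<bar>\<nu> (q k) a\<bar>))"
  have N1: "N k \<ge> 1" for k by (simp add: N_def sum_nonneg)
  have Npos: "N k > 0" for k using N1[of k] by linarith
  have "\<bar>\<nu> (q k) a / N k\<bar> \<le> 1" if "a \<in> A" for a k
  proof -
    have "\<bar>\<nu> (q k) a\<bar> \<le> (\<Sum>a\<in>A. \<bar>\<nu> (q k) a\<bar>)"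
      using that \<open>finite A\<close> by (intro member_le_sum) auto
    then have "\<bar>\<nu> (q k) a\<bar> \<le> N k" by (simp add: N_def)
    then show ?thesis using Npos[of k] by (simp add: abs_divide)
  qed
  then obtain l p where p: "strict_mono (p :: nat \<Rightarrow> nat)"
    and l: "\<And>a. a \<in> A \<Longrightarrow> (\<lambda>k. \<nu> (q (p k)) a / N (p k)) \<longlonglongrightarrow> l a"
    using finite_family_bounded_subseq[OF \<open>finite A\<close>, of "\<lambda>a k. \<nu> (q k) a / N k" 1] by blast
  define r where "r = q \<circ> p"
  define M where "M = N \<circ> p"
  have r: "strict_mono r" using q(1) p by (simp add: r_def strict_mono_o)
  have M1: "M k \<ge> 1" and Mpos: "M k > 0" for k using N1 Npos by (simp_all add: M_def)
  have l: "(\<lambda>k. \<nu> (r k) a / M k) \<longlonglongrightarrow> l a" if "a \<in> A" for a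
    using l[OF that] by (simp add: r_def M_def)
  define \<tau> where "\<tau> = 1 - (\<Sum>a\<in>A. \<bar>l a\<bar>)"
  \<comment> \<open>The normalised vector has sum norm one, so \<open>1 / M k\<close> is determined
    by the other entries and converges without a further subsequence.\<close>
  have M_eq: "1 / M k = 1 - (\<Sum>a\<in>A. \<bar>\<nu> (r k) a / M k\<bar>)" for k
  proof -
    have "(\<Sum>a\<in>A. \<bar>\<nu> (r k) a / M k\<bar>) = (\<Sum>a\<in>A. \<bar>\<nu> (r k) a\<bar>) / M k"
      using Mpos[of k] by (simp add: abs_divide sum_divide_distrib)
    also have "\<dots> = (M k - 1) / M k" by (simp add: M_def N_def r_def)
    finally show ?thesis using Mpos[of k] by (simp add: diff_divide_distrib)
  qed
  have inv: "(\<lambda>k. 1 / M k) \<longlonglongrightarrow> \<tau>"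
    unfolding M_eq \<tau>_def by (intro tendsto_intros l)
  have "\<tau> \<ge> 0"
    by (rule tendsto_lowerbound[OF inv]) (auto intro!: always_eventually less_imp_le[OF Mpos])
  have Xr: "(\<lambda>k. X (r k)) \<longlonglongrightarrow> x" using LIMSEQ_subseq_LIMSEQ[OF X r] by (simp add: o_def)
  have "(\<lambda>k. (1 / M k) *\<^sub>R (D0 (X (r k)) + (X (r k) - x))
      + (\<Sum>a\<in>A. (\<nu> (r k) a / M k) *\<^sub>R D a (X (r k))))
    \<longlonglongrightarrow> \<tau> *\<^sub>R (D0 x + (x - x)) + (\<Sum>a\<in>A. l a *\<^sub>R D a x)"
    by (intro tendsto_intros inv l Xr isCont_tendsto_compose[OF D0] isCont_tendsto_compose[OF D])
  moreover have "(1 / M k) *\<^sub>R (D0 (X (r k)) + (X (r k) - x))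
      + (\<Sum>a\<in>A. (\<nu> (r k) a / M k) *\<^sub>R D a (X (r k))) = 0" for k
  proof -
    have "(1 / M k) *\<^sub>R (D0 (X (r k)) + (X (r k) - x) + (\<Sum>a\<in>A. \<nu> (r k) a *\<^sub>R D a (X (r k)))) = 0"
      unfolding eq by simp
    then show ?thesis by (simp add: scaleR_add_right scaleR_sum_right)
  qed
  ultimately have "\<tau> *\<^sub>R D0 x + (\<Sum>a\<in>A. l a *\<^sub>R D a x) = 0"
    by (simp add: LIMSEQ_const_iff)
  then show ?thesis
    using r q(2) Mpos l \<open>\<tau> \<ge> 0\<close>
    by (intro exI[of _ r] exI[of _ S] exI[of _ M] exI[of _ \<tau>] exI[of _ l]) (auto simp: r_def \<tau>_def)
qed

text \<open>In the limit the strict inequalities become weak ones, and feasibility of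
  \<open>x\<close> does the rest. For \<open>G\<close>, the limits \<open>0 \<le> G \<le> H\<close>
  and \<open>G * H \<le> 0\<close> give \<open>G = 0\<close>. For \<open>H\<close>, a positive value
  would force \<open>G \<le> 0\<close>, contradicting \<open>H \<le> max G 0\<close>.\<close>

lemma violated_limit:
  assumes "mpvc_C1 P" and x: "x \<in> feasible P" and Y: "Y \<longlonglongrightarrow> x"
    and viol: "\<And>k. violated P (Y k) a" and a: "a \<in> constr_idx P"
  shows "a \<in> {1..num_eq P} <+> (I_g P x <+> ((I_pz P x \<union> I_zz P x) <+>
    (I_zp P x \<union> I_zz P x \<union> I_zn P x)))"
proof -
  have conv: "(\<lambda>k. constr P b (Y k)) \<longlonglongrightarrow> constr P b x" if "b \<in> constr_idx P" for b
    using cont_differentiableD(3)[OF cont_differentiable_constr[OF assms(1) that]] Y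
    by (intro isCont_tendsto_compose[of x "constr P b"]) (auto simp: continuous_on_eq_continuous_at)
  consider (h) i where "a = Inl i" "i \<in> {1..num_eq P}"
    | (g) i where "a = Inr (Inl i)" "i \<in> {1..num_ineq P}"
    | (G) i where "a = Inr (Inr (Inl i))" "i \<in> {1..num_van P}"
    | (H) i where "a = Inr (Inr (Inr i))" "i \<in> {1..num_van P}"
    using a by (auto simp: constr_idx_def)
  then show ?thesis
  proof cases
    case h
    then show ?thesis by auto
  next
    case g
    have "ineq P i x \<ge> 0"
      using conv[OF a] viol g by (intro tendsto_lowerbound[OF _ always_eventually]) (auto intro: less_imp_le)
    moreover have "ineq P i x \<le> 0" using x g by (auto simp: feasible_def)
    ultimately show ?thesis using g by (auto simp: I_g_def)
  next
    case G
    then have lim: "(\<lambda>k. vanG P i (Y k)) \<longlonglongrightarrow> vanG P i x" "(\<lambda>k. vanH P i (Y k)) \<longlonglongrightarrow> vanH P i x"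
      using conv[of "Inr (Inr (Inl i))"] conv[of "Inr (Inr (Inr i))"] by auto
    have "0 \<le> vanG P i x"
      using viol G by (intro tendsto_lowerbound[OF lim(1) always_eventually]) (auto intro: less_imp_le)
    moreover have "vanG P i x \<le> vanH P i x"
      using viol G by (intro tendsto_le[OF _ lim(2,1) always_eventually]) (auto intro: less_imp_le)
    moreover have "vanH P i x \<ge> 0" "vanG P i x * vanH P i x \<le> 0"
      using x G by (auto simp: feasible_def)
    ultimately have "vanG P i x = 0" by (auto simp: mult_le_0_iff)
    then show ?thesis using G \<open>vanH P i x \<ge> 0\<close> by (auto simp: I_pz_def I_zz_def)
  next
    case H
    then have lim: "(\<lambda>k. vanG P i (Y k)) \<longlonglongrightarrow> vanG P i x" "(\<lambda>k. vanH P i (Y k)) \<longlonglongrightarrow> vanH P i x"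
      using conv[of "Inr (Inr (Inl i))"] conv[of "Inr (Inr (Inr i))"] by auto
    have "vanH P i (Y k) \<le> max (vanG P i (Y k)) 0" for k
      using viol[of k] by (simp only: H violated_simps)
    then have "vanH P i x \<le> max (vanG P i x) 0"
      by (intro tendsto_le[OF _ tendsto_max[OF lim(1) tendsto_const] lim(2) always_eventually]) auto
    moreover have "vanH P i x \<ge> 0" "vanG P i x * vanH P i x \<le> 0"
      using x H by (auto simp: feasible_def)
    ultimately have "vanH P i x = 0" by (auto simp: mult_le_0_iff max_def split: if_splits)
    then show ?thesis using H by (auto simp: I_zp_def I_zz_def I_zn_def)
  qed
qed

text \<open>The multipliers \<open>l\<close> carry the sign of the summand, so that \<open>\<eta>\<^sup>H = - l\<close> on the last
  block.\<close>

lemma mpvc_cpld_dependent: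
  assumes cpld: "mpvc_cpld P x" and "S \<subseteq> constr_idx P"
    and S: "S \<subseteq> {1..num_eq P} <+> (I_g P x <+> ((I_pz P x \<union> I_zz P x) <+>
      (I_zp P x \<union> I_zz P x \<union> I_zn P x)))"
    and l0: "\<And>a. a \<notin> S \<Longrightarrow> l a = 0" and nz: "a \<in> S" "l a \<noteq> 0"
    and nonneg: "\<And>i. l (Inr (Inl i)) \<ge> 0"
    and compl: "\<And>i. l (Inr (Inr (Inl i))) * l (Inr (Inr (Inr i))) = 0"
    and sum0: "(\<Sum>a\<in>constr_idx P. l a *\<^sub>R grad (constr P a) x) = 0"
  shows "\<exists>U. open U \<and> x \<in> U \<and> (\<forall>y\<in>U. family_dependent S (\<lambda>a. grad (constr P a) y))"
proof -
  define Ih where "Ih = {i. Inl i \<in> S}"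
  define J where "J = {i. Inr (Inl i) \<in> S}"
  define LG where "LG = {i. Inr (Inr (Inl i)) \<in> S}"
  define LH where "LH = {i. Inr (Inr (Inr i)) \<in> S}"
  note defs = Ih_def J_def LG_def LH_def
  have S_eq: "S = Ih <+> (J <+> (LG <+> LH))"
  proof (rule set_eqI)
    fix a :: "nat + nat + nat + nat"
    consider i where "a = Inl i" | i where "a = Inr (Inl i)"
      | i where "a = Inr (Inr (Inl i))" | i where "a = Inr (Inr (Inr i))"
      by (metis sum.exhaust)
    then show "a \<in> S \<longleftrightarrow> a \<in> Ih <+> (J <+> (LG <+> LH))"
      by cases (auto simp: defs)
  qed
  have "finite S" using finite_subset[OF assms(2) finite_constr_idx] .
  then have fin: "finite Ih" "finite J" "finite LG" "finite LH"
    unfolding S_eq by (auto simp: finite_Plus_iff)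
  have sub: "Ih \<subseteq> {1..num_eq P}" "J \<subseteq> I_g P x" "LG \<subseteq> I_pz P x \<union> I_zz P x"
    "LH \<subseteq> I_zp P x \<union> I_zz P x \<union> I_zn P x"
    using S by (auto simp: defs)
  have "(\<Sum>a\<in>S. l a *\<^sub>R grad (constr P a) x) = 0"
    using sum0 l0 assms(2) finite_constr_idx
    by (subst sum.mono_neutral_left[of "constr_idx P"]) auto
  then have eq: "(\<Sum>j\<in>J. l (Inr (Inl j)) *\<^sub>R grad (ineq P j) x)
      + (\<Sum>i\<in>Ih. l (Inl i) *\<^sub>R grad (eqn P i) x)
      + (\<Sum>i\<in>LG. l (Inr (Inr (Inl i))) *\<^sub>R grad (vanG P i) x)
      - (\<Sum>i\<in>LH. (- l (Inr (Inr (Inr i)))) *\<^sub>R grad (vanH P i) x) = 0"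
    unfolding S_eq using fin by (simp add: sum.Plus o_def sum_negf algebra_simps)
  have nz': "(\<exists>j\<in>J. l (Inr (Inl j)) \<noteq> 0) \<or> (\<exists>i\<in>Ih. l (Inl i) \<noteq> 0) \<or>
      (\<exists>i\<in>LH. - l (Inr (Inr (Inr i))) \<noteq> 0) \<or> (\<exists>i\<in>LG. l (Inr (Inr (Inl i))) \<noteq> 0)"
    using nz unfolding S_eq by auto
  have "\<exists>U. open U \<and> x \<in> U \<and>
           (\<forall>y\<in>U. family_dependent (Ih <+> (J <+> (LG <+> LH)))
              (case_sum (\<lambda>i. grad (eqn P i) y)
                (case_sum (\<lambda>j. grad (ineq P j) y)
                  (case_sum (\<lambda>l. grad (vanG P l) y) (\<lambda>l. grad (vanH P l) y)))))"
  proof (rule cpld[unfolded mpvc_cpld_def, THEN conjunct2, rule_format, OF sub(1,2,4,3)],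
      intro exI conjI)
    show "\<forall>j\<in>J. l (Inr (Inl j)) \<ge> 0" using nonneg by blast
    show "\<forall>i. i \<notin> LG \<longrightarrow> l (Inr (Inr (Inl i))) = 0" using l0 by (auto simp: defs)
    show "\<forall>i. i \<notin> LH \<longrightarrow> - l (Inr (Inr (Inr i))) = 0" using l0 by (auto simp: defs)
    show "\<forall>i\<in>I_zz P x. l (Inr (Inr (Inl i))) * - l (Inr (Inr (Inr i))) = 0"
      using compl by simp
  qed (fact nz' eq)+
  moreover have "case_sum (\<lambda>i. grad (eqn P i) y)
      (case_sum (\<lambda>j. grad (ineq P j) y)
        (case_sum (\<lambda>l. grad (vanG P l) y) (\<lambda>l. grad (vanH P l) y)))
    = (\<lambda>a. grad (constr P a) y)" for y
    by (auto simp: fun_eq_iff split: sum.split)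
  ultimately show ?thesis unfolding S_eq by simp
qed

section \<open>Boundedness of the multipliers by CPLD, and enhanced M-stationarity\<close>

theorem corollary4p3:
  fixes P :: "'n::finite mpvc" and x :: "real ^ 'n"
  assumes "mpvc_C1 P"
    and "local_minimizer P x"
    and "mpvc_cpld P x"
  shows "enhanced_M_stationary P x"
proof -
  let ?A = "constr_idx P"
  note C1 = assms(1)
  have x: "x \<in> feasible P" using assms(2) by (simp add: local_minimizer_def)
  have "\<forall>k. \<exists>y \<nu>. dist y x < inverse (real (Suc k)) \<and>
      grad (obj P) y + (y - x) + (\<Sum>a\<in>?A. \<nu> a *\<^sub>R grad (constr P a) y) = 0 \<and>
      (\<forall>a\<in>?A. \<nu> a \<noteq> 0 \<longrightarrow> \<nu> a * constr P a y > 0 \<and> violated P y a) \<and>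
      \<not> family_dependent {a\<in>?A. \<nu> a \<noteq> 0} (\<lambda>a. grad (constr P a) y)"
    by (intro allI approximate_multipliers[OF assms(1,2)]) simp
  from choice[OF this] obtain X where
    "\<forall>k. \<exists>\<nu>. dist (X k) x < inverse (real (Suc k)) \<and>
      grad (obj P) (X k) + (X k - x) + (\<Sum>a\<in>?A. \<nu> a *\<^sub>R grad (constr P a) (X k)) = 0 \<and>
      (\<forall>a\<in>?A. \<nu> a \<noteq> 0 \<longrightarrow> \<nu> a * constr P a (X k) > 0 \<and> violated P (X k) a) \<and>
      \<not> family_dependent {a\<in>?A. \<nu> a \<noteq> 0} (\<lambda>a. grad (constr P a) (X k))" ..
  from choice[OF this] obtain \<nu> where approx:
    "\<forall>k. dist (X k) x < inverse (real (Suc k)) \<and>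
      grad (obj P) (X k) + (X k - x) + (\<Sum>a\<in>?A. \<nu> k a *\<^sub>R grad (constr P a) (X k)) = 0 \<and>
      (\<forall>a\<in>?A. \<nu> k a \<noteq> 0 \<longrightarrow> \<nu> k a * constr P a (X k) > 0 \<and> violated P (X k) a) \<and>
      \<not> family_dependent {a\<in>?A. \<nu> k a \<noteq> 0} (\<lambda>a. grad (constr P a) (X k))" ..
  have dist: "dist (X k) x < inverse (real (Suc k))"
    and grad0: "grad (obj P) (X k) + (X k - x)
      + (\<Sum>a\<in>?A. \<nu> k a *\<^sub>R grad (constr P a) (X k)) = 0"
    and indep: "\<not> family_dependent {a\<in>?A. \<nu> k a \<noteq> 0} (\<lambda>a. grad (constr P a) (X k))" for k
    using approx by blast+
  have \<nu>: "\<nu> k a * constr P a (X k) > 0 \<and> violated P (X k) a" if "a \<in> ?A" "\<nu> k a \<noteq> 0" for k a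
    using approx that by blast
  have X: "X \<longlonglongrightarrow> x"
    unfolding tendsto_dist_iff[of X]
    using less_imp_le[OF dist]
    by (intro tendsto_sandwich[OF _ _ tendsto_const LIMSEQ_inverse_real_of_nat] always_eventually)
      auto
  have isCont: "isCont (grad (obj P)) x" "\<And>a. a \<in> ?A \<Longrightarrow> isCont (grad (constr P a)) x"
    using C1 cont_differentiableD(2) cont_differentiable_constr[OF C1]
    unfolding mpvc_C1_def by (auto simp: continuous_on_eq_continuous_at)
  obtain r S M \<tau> l where r: "strict_mono (r :: nat \<Rightarrow> nat)"
    and S: "\<And>k. {a\<in>?A. \<nu> (r k) a \<noteq> 0} = S"
    and M: "\<And>k. M k > (0::real)"
    and lim: "\<And>a. a \<in> ?A \<Longrightarrow> (\<lambda>k. \<nu> (r k) a / M k) \<longlonglongrightarrow> l a"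
    and \<tau>: "\<tau> \<ge> 0" "\<tau> + (\<Sum>a\<in>?A. \<bar>l a\<bar>) = 1"
    and lim_eq: "\<tau> *\<^sub>R grad (obj P) x + (\<Sum>a\<in>?A. l a *\<^sub>R grad (constr P a) x) = 0"
    using multiplier_limit[OF finite_constr_idx X isCont grad0] by blast
  define Y where "Y = X \<circ> r"
  have Y: "Y \<longlonglongrightarrow> x" unfolding Y_def using X r by (rule LIMSEQ_subseq_LIMSEQ)
  \<comment> \<open>The values of \<open>l\<close> outside the index set are arbitrary. They are
    replaced by zero, since the use of CPLD requires multipliers that vanish off
    \<open>S\<close>.\<close>
  define m where "m = (\<lambda>a. if a \<in> ?A then l a else 0)"
  have lim: "(\<lambda>k. \<nu> (r k) a / M k) \<longlonglongrightarrow> m a" if "a \<in> ?A" for a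
    using lim[OF that] that by (simp add: m_def)
  have lim_eq: "\<tau> *\<^sub>R grad (obj P) x + (\<Sum>a\<in>?A. m a *\<^sub>R grad (constr P a) x) = 0"
    and sum1: "\<tau> + (\<Sum>a\<in>?A. \<bar>m a\<bar>) = 1"
    using lim_eq \<tau>(2) by (simp_all add: m_def)
  have SA: "S \<subseteq> ?A" using S by auto
  have \<nu>0: "\<nu> (r k) a = 0" if "a \<in> ?A" "a \<notin> S" for a k using S[of k] that by auto
  have viol: "violated P (Y k) a" and pos: "\<nu> (r k) a * constr P a (Y k) > 0" if "a \<in> S" for a k
    using \<nu>[of a "r k"] S[of k] that by (auto simp: Y_def)
  have m0: "m a = 0" if "a \<notin> S" for a
  proof (cases "a \<in> ?A")
    case True
    then have "(\<lambda>k. 0) \<longlonglongrightarrow> m a" using lim[OF True] \<nu>0[OF True that] by simp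
    then show ?thesis by (simp add: LIMSEQ_const_iff)
  qed (simp add: m_def)
  have S_sub: "a \<in> {1..num_eq P} <+> (I_g P x <+> ((I_pz P x \<union> I_zz P x) <+>
      (I_zp P x \<union> I_zz P x \<union> I_zn P x)))" if "a \<in> S" for a
    using violated_limit[OF C1 x Y viol[OF that]] SA that by blast
  \<comment> \<open>If the constraint function is positive along \<open>Y\<close>, so is its
    multiplier, and the weak inequality survives in the limit.\<close>
  have nonneg: "m a \<ge> 0" if "\<And>k. constr P a (Y k) > 0 \<or> a \<notin> S" for a
  proof (cases "a \<in> S")
    case True
    have "\<nu> (r k) a / M k \<ge> 0" for k
      using pos[OF True, of k] that[of k] True M[of k]
      by (auto simp: zero_less_mult_iff)
    then show ?thesis
      using True SA by (intro tendsto_lowerbound[OF lim always_eventually]) auto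
  qed (simp add: m0)
  have nonneg_g: "m (Inr (Inl i)) \<ge> 0" for i
    using viol[of "Inr (Inl i)"] by (intro nonneg) auto
  have nonneg_G: "m (Inr (Inr (Inl i))) \<ge> 0" for i
    using viol[of "Inr (Inr (Inl i))"] by (intro nonneg) auto
  have compl: "m (Inr (Inr (Inl i))) * m (Inr (Inr (Inr i))) = 0" for i
  proof -
    \<comment> \<open>Violation in the \<open>G\<close> block means \<open>0 < G < H\<close>, in the
      \<open>H\<close> block \<open>H \<le> max G 0\<close>, so both cannot occur at one point. As
      the support is constant, the index \<open>0\<close> suffices.\<close>
    have "Inr (Inr (Inl i)) \<notin> S \<or> Inr (Inr (Inr i)) \<notin> S"
      using viol[of "Inr (Inr (Inl i))" 0] viol[of "Inr (Inr (Inr i))" 0] by fastforce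
    then show ?thesis using m0 by auto
  qed
  \<comment> \<open>Near \<open>x\<close> the function \<open>G\<close> stays negative, so violation
    in the \<open>H\<close> block reads \<open>H \<le> 0\<close> and makes the multiplier
    negative.\<close>
  have nonpos_H: "m (Inr (Inr (Inr i))) \<le> 0" if i: "i \<in> I_zn P x" for i
  proof (cases "Inr (Inr (Inr i)) \<in> S")
    case True
    have "vanG P i x < 0" "i \<in> {1..num_van P}" using i by (auto simp: I_zn_def)
    then have "continuous_on UNIV (vanG P i)"
      using C1 by (intro cont_differentiableD(3)) (auto simp: mpvc_C1_def)
    then have "(\<lambda>k. vanG P i (Y k)) \<longlonglongrightarrow> vanG P i x"
      using Y by (intro isCont_tendsto_compose[of x "vanG P i"]) (auto simp: continuous_on_eq_continuous_at)
    then have "\<forall>\<^sub>F k in sequentially. vanG P i (Y k) < 0"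
      using \<open>vanG P i x < 0\<close> by (rule order_tendstoD)
    then have "\<forall>\<^sub>F k in sequentially. \<nu> (r k) (Inr (Inr (Inr i))) / M k \<le> 0"
    proof eventually_elim
      case (elim k)
      then have "vanH P i (Y k) \<le> 0" using viol[OF True, of k] by (simp add: max_def)
      then have "\<nu> (r k) (Inr (Inr (Inr i))) < 0"
        using pos[OF True, of k] by (auto simp: zero_less_mult_iff)
      then show ?case using M[of k] by (simp add: divide_nonpos_pos)
    qed
    then show ?thesis using True SA by (intro tendsto_upperbound[OF lim]) auto
  qed (simp add: m0)
  \<comment> \<open>If \<open>\<tau>\<close> were zero, the sum norm one would make \<open>m\<close>
    a nontrivial relation among the constraint gradients at \<open>x\<close>. CPLD would then make
    the family over \<open>S\<close> dependent at \<open>Y k\<close> for large \<open>k\<close>,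
    where it is independent by construction.\<close>
  have "\<tau> \<noteq> 0"
  proof
    assume "\<tau> = 0"
    then have "\<exists>a\<in>?A. m a \<noteq> 0" using sum1 by (force intro: ccontr simp: sum.neutral)
    then obtain a where a: "a \<in> S" "m a \<noteq> 0" using m0 by blast
    have "(\<Sum>a\<in>?A. m a *\<^sub>R grad (constr P a) x) = 0" using lim_eq \<open>\<tau> = 0\<close> by simp
    from mpvc_cpld_dependent[OF assms(3) SA subsetI[OF S_sub] m0 a nonneg_g compl this]
    obtain U where U: "open U" "x \<in> U"
      "\<And>y. y \<in> U \<Longrightarrow> family_dependent S (\<lambda>a. grad (constr P a) y)" by blast
    have "\<forall>\<^sub>F k in sequentially. Y k \<in> U" using topological_tendstoD[OF Y U(1,2)] .
    then obtain k where "Y k \<in> U" by (auto simp: eventually_sequentially)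
    then show False using U(3) indep[of "r k"] S[of k] by (simp add: Y_def)
  qed
  then have \<tau>0: "\<tau> > 0" using \<tau>(1) by simp
  \<comment> \<open>A nonzero limit eventually shares its sign with the normalised multiplier, which
    has the sign of the constraint function. Indices of \<open>S\<close> whose multiplier tends to
    zero need no condition.\<close>
  have "\<forall>\<^sub>F k in sequentially. m a \<noteq> 0 \<longrightarrow> m a * constr P a (Y k) > 0" if a: "a \<in> ?A" for a
  proof (cases "m a = 0")
    case False
    then have "a \<in> S" using m0 by blast
    have "(\<lambda>k. m a * (\<nu> (r k) a / M k)) \<longlonglongrightarrow> m a * m a" by (intro tendsto_intros lim a)
    moreover have "m a * m a > 0" using False by (simp flip: power2_eq_square)
    ultimately have "\<forall>\<^sub>F k in sequentially. m a * (\<nu> (r k) a / M k) > 0" by (rule order_tendstoD)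
    then show ?thesis
    proof eventually_elim
      case (elim k)
      then show ?case
        using pos[OF \<open>a \<in> S\<close>, of k] M[of k]
        by (auto simp: zero_less_mult_iff zero_less_divide_iff divide_less_0_iff)
    qed
  qed simp
  then have "\<forall>\<^sub>F k in sequentially. \<forall>a\<in>?A. m a \<noteq> 0 \<longrightarrow> m a * constr P a (Y k) > 0"
    using finite_constr_idx by (intro eventually_ball_finite) auto
  then obtain N where N: "\<And>k a. k \<ge> N \<Longrightarrow> a \<in> ?A \<Longrightarrow> m a \<noteq> 0 \<Longrightarrow> m a * constr P a (Y k) > 0"
    unfolding eventually_sequentially by blast
  \<comment> \<open>Division by \<open>\<tau>\<close> restores coefficient one for the objective
    gradient; being positive, it keeps all signs.\<close>
  define n where "n = (\<lambda>a. m a / \<tau>)"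
  have n_pos: "n a * constr P a (Y (k + N)) > 0" if "a \<in> ?A" "n a \<noteq> 0" for a k
    using N[of "k + N" a] that \<tau>0 by (simp add: n_def)
  have n0: "n a = 0" if "a \<notin> S" for a using m0[OF that] by (simp add: n_def)
  have "(1 / \<tau>) *\<^sub>R (\<tau> *\<^sub>R grad (obj P) x + (\<Sum>a\<in>?A. m a *\<^sub>R grad (constr P a) x)) = 0"
    unfolding lim_eq by simp
  then have "grad (obj P) x + (\<Sum>a\<in>?A. n a *\<^sub>R grad (constr P a) x) = 0"
    using \<tau>0 by (simp add: n_def scaleR_add_right scaleR_sum_right)
  then have stat: "grad (obj P) x
      + (\<Sum>i\<in>{1..num_ineq P}. n (Inr (Inl i)) *\<^sub>R grad (ineq P i) x)
      + (\<Sum>i\<in>{1..num_eq P}. n (Inl i) *\<^sub>R grad (eqn P i) x)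
      + (\<Sum>i\<in>{1..num_van P}. n (Inr (Inr (Inl i))) *\<^sub>R grad (vanG P i) x)
      - (\<Sum>i\<in>{1..num_van P}. (- n (Inr (Inr (Inr i)))) *\<^sub>R grad (vanH P i) x) = 0"
    by (simp add: sum_constr_idx sum_negf algebra_simps)
  have idx: "i \<in> {1..num_eq P} \<Longrightarrow> Inl i \<in> ?A" "i \<in> {1..num_ineq P} \<Longrightarrow> Inr (Inl i) \<in> ?A"
    "i \<in> {1..num_van P} \<Longrightarrow> Inr (Inr (Inl i)) \<in> ?A" "i \<in> {1..num_van P} \<Longrightarrow> Inr (Inr (Inr i)) \<in> ?A" for i
    by simp_all
  show ?thesis
    unfolding enhanced_M_stationary_def
  proof (intro conjI exI impI, rule x, rule stat)
    show "\<forall>i\<in>I_g P x. n (Inr (Inl i)) \<ge> 0" using nonneg_g \<tau>0 by (simp add: n_def)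
    show "\<forall>i\<in>{1..num_ineq P} - I_g P x. n (Inr (Inl i)) = 0"
      using n0 S_sub by fastforce
    show "\<forall>i\<in>I_pn P x \<union> I_zn P x \<union> I_zp P x. n (Inr (Inr (Inl i))) = 0"
    proof
      fix i assume "i \<in> I_pn P x \<union> I_zn P x \<union> I_zp P x"
      then have "i \<notin> I_pz P x \<union> I_zz P x"
        by (auto simp: I_pn_def I_zn_def I_zp_def I_pz_def I_zz_def)
      then show "n (Inr (Inr (Inl i))) = 0" using S_sub[of "Inr (Inr (Inl i))"] n0 by auto
    qed
    show "\<forall>i\<in>I_pz P x \<union> I_zz P x. n (Inr (Inr (Inl i))) \<ge> 0"
      using nonneg_G \<tau>0 by (simp add: n_def)
    show "\<forall>i\<in>I_p P x. - n (Inr (Inr (Inr i))) = 0"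
    proof
      fix i assume "i \<in> I_p P x"
      then have "i \<notin> I_zp P x \<union> I_zz P x \<union> I_zn P x"
        by (auto simp: I_p_def I_zn_def I_zp_def I_zz_def)
      then show "- n (Inr (Inr (Inr i))) = 0" using S_sub[of "Inr (Inr (Inr i))"] n0 by auto
    qed
    show "\<forall>i\<in>I_zn P x. - n (Inr (Inr (Inr i))) \<ge> 0"
      using nonpos_H \<tau>0 by (simp add: n_def divide_nonpos_pos)
    show "\<forall>i\<in>I_zz P x. n (Inr (Inr (Inl i))) * - n (Inr (Inr (Inr i))) = 0"
      using compl by (simp add: n_def)
    \<comment> \<open>The sign conditions are required for every index, so the sequence starts at
      \<open>N\<close>, from where on they hold.\<close>
    show "(\<lambda>k. Y (k + N)) \<longlonglongrightarrow> x" using Y by (rule LIMSEQ_ignore_initial_segment)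
    show "\<forall>k. (\<forall>i\<in>{1..num_ineq P}. n (Inr (Inl i)) > 0 \<longrightarrow>
          n (Inr (Inl i)) * ineq P i (Y (k + N)) > 0) \<and>
        (\<forall>i\<in>{1..num_eq P}. n (Inl i) \<noteq> 0 \<longrightarrow> n (Inl i) * eqn P i (Y (k + N)) > 0) \<and>
        (\<forall>i\<in>{1..num_van P}. - n (Inr (Inr (Inr i))) \<noteq> 0 \<longrightarrow>
          - n (Inr (Inr (Inr i))) * vanH P i (Y (k + N)) < 0) \<and>
        (\<forall>i\<in>{1..num_van P}. n (Inr (Inr (Inl i))) > 0 \<longrightarrow>
          n (Inr (Inr (Inl i))) * vanG P i (Y (k + N)) > 0)"
      using n_pos[OF idx(1)] n_pos[OF idx(2)] n_pos[OF idx(3)] n_pos[OF idx(4)] by simp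
  qed
qed

end
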